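(* Given a nonempty, closed and convex set $C \subseteq \mathbb{R}^n$, consider the statements (i) $e[C, 0^+C] < +\infty$; (ii) $C$ is self-bounded; (iii) there is a compact set $K \subseteq \mathbb{R}^n$ such that $K + 0^+C \supseteq C$. Then the following implications are true: (i) $\Leftrightarrow$ (iii) and (ii) $\Rightarrow$ (iii). If, additionally, $0^+C$ is solid, then (i), (ii) and (iii) are equivalent.
   Context: $0^+C$ denotes the recession cone of $C$. A set $C \subsetneq \mathbb{R}^n$ with a nontrivial recession cone (i.e. $0^+C \neq \{0\}$) is called self-bounded if there exists $y \in \mathbb{R}^n$ such that $\{y\} + 0^+C \supseteq C$. For nonempty $C_1,C_2\subseteq\mathbb{R}^n$ the excess of $C_1$ over $C_2$ is $e[C_1,C_2] = \sup_{c_1 \in C_1} \inf_{c_2 \in C_2} \|c_1-c_2\|$, with $\|\cdot\|$ the Euclidean norm. The plus sign denotes Minkowski addition. A cone is solid if it has nonempty interior.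
   Formalization: The final equivalence of (i), (ii) and (iii) for solid recession cone is stated only for C different from the whole space, since for C = R^n statements (i) and (iii) hold while C is not self-bounded by definition. *)

theory Defs
  imports "HOL-Analysis.Analysis"
begin

definition recession_cone :: "'a::real_vector set \<Rightarrow> 'a set" where
  "recession_cone C = {d. \<forall>x\<in>C. \<forall>t\<ge>0. x + t *\<^sub>R d \<in> C}"

text \<open>The Minkowski sum of sets is the operation \<open>+\<close> from \<^theory>\<open>HOL-Library.Set_Algebras\<close>.\<close>

text \<open>Properness of \<open>C\<close> and nontriviality of its recession cone are part of the notion: in
  particular the whole space is not self-bounded, although \<open>UNIV \<subseteq> {y} + recession_cone UNIV\<close>
  holds.\<close>

definition self_bounded :: "'a::real_vector set \<Rightarrow> bool" where
  "self_bounded C \<longleftrightarrow>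
     C \<subset> UNIV \<and> recession_cone C \<noteq> {0} \<and> (\<exists>y. {y} + recession_cone C \<supseteq> C)"

text \<open>The excess may be infinite, so it takes values in the extended reals. It is meant for
  nonempty arguments.\<close>

definition excess :: "'a::real_normed_vector set \<Rightarrow> 'a set \<Rightarrow> ereal" where
  "excess C1 C2 = (SUP c1\<in>C1. INF c2\<in>C2. ereal (norm (c1 - c2)))"

definition solid :: "'a::topological_space set \<Rightarrow> bool" where
  "solid S \<longleftrightarrow> interior S \<noteq> {}"

end

theory Submission
  imports Defs
begin

text \<open>If the ball of radius \<open>e\<close> about \<open>z\<close> lies in the cone, then so does the ball of radius
  \<open>t * e\<close> about \<open>t *\<^sub>R z\<close>. Hence for large \<open>t\<close> the cone with apex \<open>- (t *\<^sub>R z)\<close> absorbs a given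
  bounded set \<open>K\<close>, and then \<open>K\<close> plus the cone too, the cone being closed under addition.\<close>

lemma recession_cone_scale:
  assumes "d \<in> recession_cone C" and "0 \<le> s"
  shows "s *\<^sub>R d \<in> recession_cone C"
  unfolding recession_cone_def
proof (intro CollectI ballI allI impI)
  fix x and t :: real
  assume "x \<in> C" and "0 \<le> t"
  then have "x + (t * s) *\<^sub>R d \<in> C"
    using assms unfolding recession_cone_def by simp
  then show "x + t *\<^sub>R s *\<^sub>R d \<in> C" by simp
qed

lemma recession_cone_add:
  assumes "d \<in> recession_cone C" and "e \<in> recession_cone C"
  shows "d + e \<in> recession_cone C"
  unfolding recession_cone_def
proof (intro CollectI ballI allI impI)
  fix x and t :: real
  assume "x \<in> C" and "0 \<le> t"
  \<comment> \<open>Moving along \<open>d\<close> ends at a point of \<open>C\<close>, which then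
    serves as the base point for moving along \<open>e\<close>.\<close>
  then have "(x + t *\<^sub>R d) + t *\<^sub>R e \<in> C"
    using assms unfolding recession_cone_def by blast
  then show "x + t *\<^sub>R (d + e) \<in> C" by (simp add: algebra_simps)
qed

text \<open>A finite bound on the distances to \<open>D\<close> puts the differences
  \<open>c - d\<close>, for suitable \<open>d\<close>, into one ball, which is compact in a
  Euclidean space. Conversely, a norm bound for \<open>K\<close> bounds all these distances.\<close>

lemma excess_finite_iff_compact_sum:
  fixes C D :: "'a::euclidean_space set"
  shows "excess C D < \<infinity> \<longleftrightarrow> (\<exists>K. compact K \<and> C \<subseteq> K + D)"
proof
  assume "excess C D < \<infinity>"
  \<comment> \<open>The bound is strict because the infimum over \<open>D\<close> need not be
    attained: an infimum strictly below \<open>M\<close> still yields some \<open>d\<close> with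
    \<open>norm (c - d) < M\<close>.\<close>
  then obtain M :: real where M: "excess C D < ereal M"
    using ereal_dense2 by blast
  have "C \<subseteq> cball 0 M + D"
  proof
    fix c assume "c \<in> C"
    then have "(INF d\<in>D. ereal (norm (c - d))) \<le> excess C D"
      unfolding excess_def by (rule SUP_upper)
    then have "(INF d\<in>D. ereal (norm (c - d))) < ereal M"
      using M by (rule order_le_less_trans)
    then obtain d where "d \<in> D" "norm (c - d) < M"
      by (auto simp: INF_less_iff)
    then have "(c - d) + d \<in> cball 0 M + D"
      by (intro set_plus_intro) auto
    then show "c \<in> cball 0 M + D" by simp
  qed
  then show "\<exists>K. compact K \<and> C \<subseteq> K + D" using compact_cball by blast
next
  assume "\<exists>K. compact K \<and> C \<subseteq> K + D"
  then obtain K where K: "compact K" "C \<subseteq> K + D" by blast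
  then obtain B where B: "\<And>k. k \<in> K \<Longrightarrow> norm k \<le> B"
    using compact_imp_bounded bounded_iff by metis
  have "excess C D \<le> ereal B"
    unfolding excess_def
  proof (rule SUP_least)
    fix c assume "c \<in> C"
    then obtain k d where "k \<in> K" "d \<in> D" "c = k + d"
      using K by (blast elim: set_plus_elim)
    \<comment> \<open>The single point \<open>d\<close> bounds the infimum, since
      \<open>c - d = k\<close>.\<close>
    then show "(INF d\<in>D. ereal (norm (c - d))) \<le> ereal B"
      using B by (intro INF_lower2[of d]) auto
  qed
  then show "excess C D < \<infinity>" by (rule order_le_less_trans) simp
qed

text \<open>Solidity is essential here: if the cone is a ray in the plane, no translate of it
  contains a disc.\<close>

lemma bounded_subset_translated_recession_cone:
  fixes C K :: "'a::real_normed_vector set"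
  assumes "bounded K" and "solid (recession_cone C)"
  obtains y where "K \<subseteq> {y} + recession_cone C"
proof -
  obtain z e where e: "e > 0" and ball: "ball z e \<subseteq> recession_cone C"
    using assms(2) unfolding solid_def by (meson all_not_in_conv mem_interior)
  obtain B where B: "B > 0" "\<And>k. k \<in> K \<Longrightarrow> norm k \<le> B"
    using assms(1) bounded_pos by metis
  \<comment> \<open>This gives \<open>e * t = B + 1\<close>, which strictly exceeds every norm in
    \<open>K\<close>, so that \<open>K\<close> shrunk by the factor \<open>1 / t\<close> fits into
    the open ball of radius \<open>e\<close>.\<close>
  define t where "t = (B + 1) / e"
  have t: "t > 0" using B e by (simp add: t_def)
  have "K \<subseteq> {- (t *\<^sub>R z)} + recession_cone C"
  proof
    fix k assume "k \<in> K"
    then have "norm k < e * t" using B e by (simp add: t_def) (smt (verit))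
    then have "norm ((1 / t) *\<^sub>R k) < e" using t by (simp add: divide_simps)
    then have "z + (1 / t) *\<^sub>R k \<in> recession_cone C"
      using ball by (auto simp: dist_norm subset_iff)
    then have "t *\<^sub>R (z + (1 / t) *\<^sub>R k) \<in> recession_cone C"
      using t by (intro recession_cone_scale) auto
    then have "- (t *\<^sub>R z) + t *\<^sub>R (z + (1 / t) *\<^sub>R k) \<in> {- (t *\<^sub>R z)} + recession_cone C"
      by (intro set_plus_intro) auto
    then show "k \<in> {- (t *\<^sub>R z)} + recession_cone C"
      using t by (simp add: algebra_simps)
  qed
  then show thesis by (rule that)
qed

lemma self_bounded_imp_compact_sum:
  fixes C :: "'a::real_normed_vector set"
  assumes "self_bounded C"
  shows "\<exists>K. compact K \<and> C \<subseteq> K + recession_cone C"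
  using assms compact_sing unfolding self_bounded_def by blast

lemma compact_sum_imp_self_bounded:
  fixes C K :: "'a::euclidean_space set"
  assumes "solid (recession_cone C)" and "C \<noteq> UNIV"
    and "compact K" and "C \<subseteq> K + recession_cone C"
  shows "self_bounded C"
proof -
  obtain y where y: "K \<subseteq> {y} + recession_cone C"
    using bounded_subset_translated_recession_cone assms compact_imp_bounded by metis
  have "C \<subseteq> {y} + recession_cone C"
  proof
    fix c assume "c \<in> C"
    then obtain k d where "k \<in> K" and d: "d \<in> recession_cone C" and c: "c = k + d"
      using assms(4) by (blast elim: set_plus_elim)
    then obtain d' where d': "d' \<in> recession_cone C" and k: "k = y + d'"
      using y by (blast elim: set_plus_elim)
    have "y + (d' + d) \<in> {y} + recession_cone C"
      using recession_cone_add[OF d' d] by (intro set_plus_intro) auto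
    then show "c \<in> {y} + recession_cone C" by (simp add: c k add.assoc)
  qed
  \<comment> \<open>A single point has empty interior in a Euclidean space.\<close>
  moreover have "recession_cone C \<noteq> {0}"
    using assms(1) unfolding solid_def by (metis interior_singleton)
  ultimately show ?thesis using assms(2) unfolding self_bounded_def by blast
qed

text \<open>The condition \<open>C \<noteq> UNIV\<close> accompanies solidity because the whole
  space is its own recession cone: its excess is 0 and \<open>K = {0}\<close> works, yet it is not
  self-bounded by definition.\<close>

theorem theorem3p4:
  fixes C :: "(real ^ 'n) set"
  assumes "C \<noteq> {}" and "closed C" and "convex C"
  shows "(excess C (recession_cone C) < \<infinity> \<longleftrightarrow> (\<exists>K. compact K \<and> K + recession_cone C \<supseteq> C))
    \<and> (self_bounded C \<longrightarrow> (\<exists>K. compact K \<and> K + recession_cone C \<supseteq> C))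
    \<and> (solid (recession_cone C) \<and> C \<noteq> UNIV \<longrightarrow>
         (excess C (recession_cone C) < \<infinity> \<longleftrightarrow> self_bounded C)
       \<and> (self_bounded C \<longleftrightarrow> (\<exists>K. compact K \<and> K + recession_cone C \<supseteq> C)))"
  using excess_finite_iff_compact_sum[of C "recession_cone C"] self_bounded_imp_compact_sum[of C]
    compact_sum_imp_self_bounded[of C]
  by blast

end
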